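(* Let $n\geq 1$ and $k\geq 1$. Every complex polynomial of degree $k$ in $\mathbb{A}_n$ has at least one root in $\mathbb{A}_n$. That is: if $\xi_0,\dots,\xi_{k-1}\in\mathbb{A}_n$ are pairwise $\mathbb{C}$-dependent, then there is $x\in\mathbb{A}_n$, $\mathbb{C}$-dependent with each $\xi_i$ ($0\le i\le k-1$), such that $$\xi_0+\xi_1x+\xi_2x^2+\cdots+\xi_{k-1}x^{k-1}+x^k=0.$$
   Context: The Cayley-Dickson algebras $\mathbb{A}_n=\mathbb{R}^{2^n}$ are defined by $\mathbb{A}_0=\mathbb{R}$ with $\overline{x}=x$, and $\mathbb{A}_{n+1}=\mathbb{A}_n\times\mathbb{A}_n$ with product $(a,b)(x,y)=(ax-\overline{y}b,\;ya+b\overline{x})$ and conjugation $\overline{(x_1,x_2)}=(\overline{x_1},-x_2)$. The first canonical basis vector $e_0$ is the unit, $\mathrm{Im}(\mathbb{A}_n)$ is the span of the remaining canonical basis vectors, and $\mathbb{A}_n=\mathbb{R}e_0\oplus\mathrm{Im}(\mathbb{A}_n)$ gives the real and imaginary parts of an element. Two elements of $\mathbb{A}_n$ are $\mathbb{C}$-dependent if their imaginary parts are linearly dependent over $\mathbb{R}$ (in particular every element is $\mathbb{C}$-dependent with any real element). Powers: $x^0=e_0$, $x^{m+1}=x^m x$ (the algebras are power-associative). A complex polynomial of degree $k$ in $\mathbb{A}_n$ is a function $p(x)=\xi_0+\xi_1x+\cdots+\xi_{k-1}x^{k-1}+x^k$ where the coefficients $\xi_i$ are $\mathbb{C}$-dependent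 among themselves and with the variable $x$. *)

theory Defs
  imports Complex_Main "HOL-Library.Function_Algebras"
begin

text \<open>
  The vector space \<open>\<real>\<^sup>N\<close>, for \<open>N = 2 ^ n\<close>, consists of the sequences vanishing from index \<open>N\<close> on;
  addition, negation and zero are the pointwise ones of \<open>Function_Algebras\<close>. The pointwise \<open>1\<close>
  and \<open>*\<close> of that theory are not the unit and the product of the algebra.
\<close>

definition CD :: "nat \<Rightarrow> (nat \<Rightarrow> real) set" where
  "CD n = {x. \<forall>i\<ge>2 ^ n. x i = 0}"

text \<open>
  The identification of \<open>CD (Suc n)\<close> with \<open>CD n \<times> CD n\<close>: the first factor holds the first
  \<open>2 ^ n\<close> coordinates, the second factor the next \<open>2 ^ n\<close>.
\<close>

definition cd_fst :: "nat \<Rightarrow> (nat \<Rightarrow> real) \<Rightarrow> nat \<Rightarrow> real" where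
  "cd_fst n x = (\<lambda>i. if i < 2 ^ n then x i else 0)"

definition cd_snd :: "nat \<Rightarrow> (nat \<Rightarrow> real) \<Rightarrow> nat \<Rightarrow> real" where
  "cd_snd n x = (\<lambda>i. if i < 2 ^ n then x (2 ^ n + i) else 0)"

definition cd_pair :: "nat \<Rightarrow> (nat \<Rightarrow> real) \<Rightarrow> (nat \<Rightarrow> real) \<Rightarrow> nat \<Rightarrow> real" where
  "cd_pair n a b = (\<lambda>i. if i < 2 ^ n then a i else b (i - 2 ^ n))"

primrec cd_conj :: "nat \<Rightarrow> (nat \<Rightarrow> real) \<Rightarrow> nat \<Rightarrow> real" where
  "cd_conj 0 x = x"
| "cd_conj (Suc n) x = cd_pair n (cd_conj n (cd_fst n x)) (- cd_snd n x)"

primrec cd_mult :: "nat \<Rightarrow> (nat \<Rightarrow> real) \<Rightarrow> (nat \<Rightarrow> real) \<Rightarrow> nat \<Rightarrow> real" where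
  "cd_mult 0 x y = (\<lambda>i. if i = 0 then x 0 * y 0 else 0)"
| "cd_mult (Suc n) u v =
    (let a = cd_fst n u; b = cd_snd n u; x = cd_fst n v; y = cd_snd n v
     in cd_pair n (cd_mult n a x - cd_mult n (cd_conj n y) b)
                  (cd_mult n y a + cd_mult n b (cd_conj n x)))"

definition cd_unit :: "nat \<Rightarrow> real" where
  "cd_unit = (\<lambda>i. if i = 0 then 1 else 0)"

primrec cd_power :: "nat \<Rightarrow> (nat \<Rightarrow> real) \<Rightarrow> nat \<Rightarrow> nat \<Rightarrow> real" where
  "cd_power n x 0 = cd_unit"
| "cd_power n x (Suc m) = cd_mult n (cd_power n x m) x"

definition cd_Im :: "(nat \<Rightarrow> real) \<Rightarrow> nat \<Rightarrow> real" where
  "cd_Im x = x(0 := 0)"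

text \<open>
  Linear dependence is that of the family \<open>(cd_Im x, cd_Im y)\<close>, not of the set
  \<open>{cd_Im x, cd_Im y}\<close>: every element is \<open>\<complex>\<close>-dependent with itself.
\<close>

definition C_dependent :: "(nat \<Rightarrow> real) \<Rightarrow> (nat \<Rightarrow> real) \<Rightarrow> bool" where
  "C_dependent x y \<longleftrightarrow>
     (\<exists>a b :: real. (a \<noteq> 0 \<or> b \<noteq> 0) \<and> (\<lambda>i. a * cd_Im x i + b * cd_Im y i) = 0)"

definition cd_monic_poly :: "nat \<Rightarrow> nat \<Rightarrow> (nat \<Rightarrow> nat \<Rightarrow> real) \<Rightarrow> (nat \<Rightarrow> real) \<Rightarrow> nat \<Rightarrow> real" where
  "cd_monic_poly n k \<xi> x = (\<Sum>i<k. cd_mult n (\<xi> i) (cd_power n x i)) + cd_power n x k"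

end

theory Submission
  imports Defs "HOL-Computational_Algebra.Fundamental_Theorem_Algebra"
begin

text \<open>
  Every imaginary \<open>u\<close> with \<open>|u| = 1\<close> satisfies \<open>u\<^sup>2 = - e\<^sub>0\<close>, because
  \<open>cd_conj x * x = |x|\<^sup>2 e\<^sub>0\<close> for all \<open>x\<close>; hence \<open>a + b \<i> \<mapsto> a e\<^sub>0 + b u\<close> embeds the complex numbers.
  Pairwise \<open>\<complex>\<close>-dependent coefficients all lie in one such copy of the complex numbers,
  where the classical fundamental theorem of algebra gives the root.
\<close>

section \<open>Linearity of conjugation and bilinearity of the product\<close>

lemma cd_fst_add: "cd_fst n (x + y) = cd_fst n x + cd_fst n y"
  and cd_snd_add: "cd_snd n (x + y) = cd_snd n x + cd_snd n y"
  and cd_fst_scale: "cd_fst n (\<lambda>i. c * x i) = (\<lambda>i. c * cd_fst n x i)"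
  and cd_snd_scale: "cd_snd n (\<lambda>i. c * x i) = (\<lambda>i. c * cd_snd n x i)"
  by (auto simp: cd_fst_def cd_snd_def)

lemma cd_pair_scale:
  "cd_pair n (\<lambda>i. t * a i) (\<lambda>i. t * b i) = (\<lambda>i. t * cd_pair n a b i)"
  by (auto simp: cd_pair_def)

lemma cd_conj_add: "cd_conj n (x + y) = cd_conj n x + cd_conj n y"
proof (induction n arbitrary: x y)
  case (Suc n)
  show ?case
    unfolding cd_conj.simps cd_fst_add cd_snd_add Suc by (auto simp: cd_pair_def)
qed simp

lemma cd_conj_scale: "cd_conj n (\<lambda>i. c * x i) = (\<lambda>i. c * cd_conj n x i)"
proof (induction n arbitrary: x)
  case (Suc n)
  show ?case
    unfolding cd_conj.simps cd_fst_scale cd_snd_scale Suc by (auto simp: cd_pair_def)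
qed simp

text \<open>The doubled product \<open>(a, b) (x, y)\<close> contains \<open>a\<close> and
  \<open>b\<close> both as left and as right factors, and likewise \<open>x\<close> and
  \<open>y\<close>. Additivity in either argument therefore needs both laws one level below, whence
  the joint induction; the same holds for scaling.\<close>

lemma cd_mult_add_left: "cd_mult n (x + y) z = cd_mult n x z + cd_mult n y z"
  and cd_mult_add_right: "cd_mult n z (x + y) = cd_mult n z x + cd_mult n z y"
proof (induction n arbitrary: x y z)
  case 0
  { case 1 show ?case by (auto simp: algebra_simps) }
  { case 2 show ?case by (auto simp: algebra_simps) }
next
  case (Suc n)
  { case 1 show ?case
      unfolding cd_mult.simps Let_def cd_fst_add cd_snd_add Suc
      by (auto simp: cd_pair_def) }
  { case 2 show ?case
      unfolding cd_mult.simps Let_def cd_fst_add cd_snd_add cd_conj_add Suc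
      by (auto simp: cd_pair_def) }
qed

lemma cd_mult_scale_left: "cd_mult n (\<lambda>i. c * x i) z = (\<lambda>i. c * cd_mult n x z i)"
  and cd_mult_scale_right: "cd_mult n z (\<lambda>i. c * x i) = (\<lambda>i. c * cd_mult n z x i)"
proof (induction n arbitrary: x z)
  case 0
  { case 1 show ?case by auto }
  { case 2 show ?case by auto }
next
  case (Suc n)
  \<comment> \<open>Pulls the common factor out of each half, so that \<open>cd_pair_scale\<close>
    can collect it.\<close>
  have scale: "(\<lambda>i. c * p i) - (\<lambda>i. c * q i) = (\<lambda>i. c * (p - q) i)"
    "(\<lambda>i. c * p i) + (\<lambda>i. c * q i) = (\<lambda>i. c * (p + q) i)" for p q :: "nat \<Rightarrow> real"
    by (auto simp: algebra_simps)
  { case 1 show ?case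
      unfolding cd_mult.simps Let_def cd_fst_scale cd_snd_scale Suc scale cd_pair_scale .. }
  { case 2 show ?case
      unfolding cd_mult.simps Let_def cd_fst_scale cd_snd_scale cd_conj_scale Suc scale
        cd_pair_scale .. }
qed

lemma cd_mult_zero_left: "cd_mult n 0 z = 0"
  using cd_mult_add_left[of n 0 0 z] by simp

lemma cd_mult_zero_right: "cd_mult n z 0 = 0"
  using cd_mult_add_right[of n z 0 0] by simp

lemma cd_mult_minus_left: "cd_mult n (- x) z = - cd_mult n x z"
proof -
  have "cd_mult n (- x) z + cd_mult n x z = 0"
    unfolding cd_mult_add_left[symmetric] by (simp only: left_minus cd_mult_zero_left)
  then show ?thesis
    by (rule minus_unique[OF trans[OF add.commute], symmetric])
qed

lemma cd_mult_minus_right: "cd_mult n z (- x) = - cd_mult n z x"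
proof -
  have "cd_mult n z (- x) + cd_mult n z x = 0"
    unfolding cd_mult_add_right[symmetric] by (simp only: left_minus cd_mult_zero_right)
  then show ?thesis
    by (rule minus_unique[OF trans[OF add.commute], symmetric])
qed

section \<open>Halves, conjugation and the unit\<close>

lemma cd_fst_in_CD: "cd_fst n x \<in> CD n"
  and cd_snd_in_CD: "cd_snd n x \<in> CD n"
  by (auto simp: CD_def cd_fst_def cd_snd_def)

lemma cd_pair_fst_snd:
  assumes "x \<in> CD (Suc n)"
  shows "cd_pair n (cd_fst n x) (cd_snd n x) = x"
  using assms by (auto simp: CD_def cd_pair_def cd_fst_def cd_snd_def fun_eq_iff)

lemma cd_fst_pair: "a \<in> CD n \<Longrightarrow> cd_fst n (cd_pair n a b) = a"
  and cd_snd_pair: "b \<in> CD n \<Longrightarrow> cd_snd n (cd_pair n a b) = b"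
  by (auto simp: CD_def cd_pair_def cd_fst_def cd_snd_def fun_eq_iff)

lemma CD_uminus: "x \<in> CD n \<Longrightarrow> - x \<in> CD n"
  by (simp add: CD_def)

lemma cd_fst_unit: "cd_fst n cd_unit = cd_unit"
  and cd_snd_unit: "cd_snd n cd_unit = 0"
  by (auto simp: cd_fst_def cd_snd_def cd_unit_def)

lemma cd_conj_in_CD: "x \<in> CD n \<Longrightarrow> cd_conj n x \<in> CD n"
proof (induction n arbitrary: x)
  case (Suc n)
  have "cd_conj n (cd_fst n x) \<in> CD n"
    by (intro Suc.IH cd_fst_in_CD)
  then show ?case
    by (auto simp: CD_def cd_pair_def cd_snd_def)
qed simp

text \<open>Conjugation recurses only into the first half, which inherits the vanishing coordinate
  0; the second half is negated outright. At level 0 that coordinate is the only one, so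
  \<open>x\<close> is 0.\<close>

lemma cd_conj_imaginary:
  assumes "x \<in> CD n" "x 0 = 0"
  shows "cd_conj n x = - x"
  using assms
proof (induction n arbitrary: x)
  case 0
  have "x i = 0" for i
    using 0 by (cases i) (auto simp: CD_def)
  then show ?case by (auto simp: fun_eq_iff)
next
  case (Suc n)
  have "cd_conj n (cd_fst n x) = - cd_fst n x"
    using Suc.prems by (intro Suc.IH cd_fst_in_CD) (simp add: cd_fst_def)
  moreover have "cd_pair n (- cd_fst n x) (- cd_snd n x)
      = - cd_pair n (cd_fst n x) (cd_snd n x)"
    by (auto simp: cd_pair_def)
  ultimately show ?case
    by (simp add: cd_pair_fst_snd[OF Suc.prems(1)])
qed

lemma cd_conj_unit: "cd_conj n cd_unit = cd_unit"
proof (induction n)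
  case (Suc n)
  then show ?case
    unfolding cd_conj.simps cd_fst_unit cd_snd_unit by (auto simp: cd_pair_def cd_unit_def)
qed simp

text \<open>In \<open>(1, 0) (x, y) = (1 x, y 1)\<close> the unit lands on the right in the second
  half, so the left law at one level rests on both laws one level below.\<close>

lemma cd_mult_unit_left: "x \<in> CD n \<Longrightarrow> cd_mult n cd_unit x = x"
  and cd_mult_unit_right: "x \<in> CD n \<Longrightarrow> cd_mult n x cd_unit = x"
proof (induction n arbitrary: x)
  case 0
  { case 1 then show ?case by (auto simp: CD_def cd_unit_def fun_eq_iff) }
  { case 2 then show ?case by (auto simp: CD_def cd_unit_def fun_eq_iff) }
next
  case (Suc n)
  note unit_simps = Let_def cd_fst_unit cd_snd_unit cd_conj_unit cd_mult_zero_left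
    cd_mult_zero_right cd_conj_in_CD cd_fst_in_CD cd_snd_in_CD cd_pair_fst_snd Suc.IH
  have conj_zero: "cd_conj n 0 = 0"
    using cd_conj_add[of n 0 0] by simp
  { case 1 then show ?case by (simp add: unit_simps) }
  { case 2 then show ?case by (simp add: unit_simps conj_zero) }
qed

section \<open>The squared norm as a product with the conjugate\<close>

lemma sum_lessThan_add: "(\<Sum>i<m + k. f i) = (\<Sum>i<m. f i) + (\<Sum>i<k. f (m + i))"
  for f :: "nat \<Rightarrow> real" and m k :: nat
  by (induction k) auto

lemma sum_cd_fst_snd:
  "(\<Sum>i<2 ^ n. (cd_fst n x i)\<^sup>2) + (\<Sum>i<2 ^ n. (cd_snd n x i)\<^sup>2) = (\<Sum>i<2 ^ Suc n. (x i)\<^sup>2)"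
proof -
  have "(\<Sum>i<2 ^ Suc n. (x i)\<^sup>2) = (\<Sum>i<2 ^ n + 2 ^ n. (x i)\<^sup>2)"
    by (simp add: mult_2)
  also have "\<dots> = (\<Sum>i<2 ^ n. (x i)\<^sup>2) + (\<Sum>i<2 ^ n. (x (2 ^ n + i))\<^sup>2)"
    by (rule sum_lessThan_add)
  finally show ?thesis
    by (simp add: cd_fst_def cd_snd_def)
qed

text \<open>Write a' for the conjugate of a. Then (a', -b) (a, b) = (a' a + b' b, b a' - b a'): the
  second half cancels by signs alone, without commutativity or associativity, and the squared norms
  of the halves add up.\<close>

lemma cd_mult_conj_self:
  assumes "x \<in> CD n"
  shows "cd_mult n (cd_conj n x) x = (\<lambda>i. (\<Sum>j<2 ^ n. (x j)\<^sup>2) * cd_unit i)"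
  using assms
proof (induction n arbitrary: x)
  case 0
  then show ?case
    by (auto simp: cd_unit_def power2_eq_square)
next
  case (Suc n)
  let ?a = "cd_fst n x" and ?b = "cd_snd n x"
  have "cd_mult (Suc n) (cd_conj (Suc n) x) x =
      cd_pair n (cd_mult n (cd_conj n ?a) ?a + cd_mult n (cd_conj n ?b) ?b) 0"
    by (simp add: Let_def cd_fst_pair cd_snd_pair cd_conj_in_CD cd_fst_in_CD cd_snd_in_CD
        CD_uminus cd_mult_minus_left cd_mult_minus_right)
  also have "\<dots> = (\<lambda>i. (\<Sum>j<2 ^ Suc n. (x j)\<^sup>2) * cd_unit i)"
    unfolding Suc.IH[OF cd_fst_in_CD] Suc.IH[OF cd_snd_in_CD] sum_cd_fst_snd[symmetric]
    by (auto simp: cd_pair_def cd_unit_def)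
  finally show ?case .
qed

section \<open>Copies of the complex numbers inside the algebra\<close>

definition complex_embed :: "(nat \<Rightarrow> real) \<Rightarrow> complex \<Rightarrow> nat \<Rightarrow> real" where
  "complex_embed u z = (\<lambda>i. Re z * cd_unit i) + (\<lambda>i. Im z * u i)"

lemma complex_embed_add: "complex_embed u (z + w) = complex_embed u z + complex_embed u w"
  by (auto simp: complex_embed_def algebra_simps)

lemma complex_embed_0: "complex_embed u 0 = 0"
  by (auto simp: complex_embed_def)

lemma complex_embed_sum:
  "complex_embed u (\<Sum>i\<in>A. f i) = (\<Sum>i\<in>A. complex_embed u (f i))"
  using sum_comp_morphism[of "complex_embed u" f A]
  by (simp add: complex_embed_0 complex_embed_add o_def)

lemma cd_unit_in_CD: "cd_unit \<in> CD n"
  by (auto simp: CD_def cd_unit_def)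

lemma complex_embed_in_CD: "u \<in> CD n \<Longrightarrow> complex_embed u z \<in> CD n"
  using cd_unit_in_CD[of n] by (auto simp: CD_def complex_embed_def)

lemma cd_Im_complex_embed: "u 0 = 0 \<Longrightarrow> cd_Im (complex_embed u z) = (\<lambda>i. Im z * u i)"
  by (auto simp: cd_Im_def complex_embed_def cd_unit_def)

text \<open>The real part is unconstrained in a copy, so membership only asks that the imaginary
  part be a multiple of \<open>u\<close>.\<close>

lemma complex_embed_eqI:
  assumes "u 0 = 0" and "cd_Im x = (\<lambda>i. b * u i)"
  shows "x = complex_embed u (Complex (x 0) b)"
proof
  fix i
  show "x i = complex_embed u (Complex (x 0) b) i"
    using assms(1) fun_cong[OF assms(2), of i]
    by (cases "i = 0") (auto simp: complex_embed_def cd_unit_def cd_Im_def)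
qed

lemma C_dependent_complex_embed:
  assumes "u 0 = 0"
  shows "C_dependent (complex_embed u z) (complex_embed u w)"
proof (cases "Im z = 0 \<and> Im w = 0")
  case True
  then show ?thesis
    unfolding C_dependent_def cd_Im_complex_embed[of u, OF assms]
    by (intro exI[of _ 1] exI[of _ 0]) auto
next
  \<comment> \<open>The imaginary parts are \<open>Im z\<close> and \<open>Im w\<close> times
    \<open>u\<close>, so cross-multiplying gives a relation; it is nontrivial only in this
    case.\<close>
  case False
  then show ?thesis
    unfolding C_dependent_def cd_Im_complex_embed[of u, OF assms]
    by (intro exI[of _ "Im w"] exI[of _ "- Im z"]) auto
qed

text \<open>Real part zero turns conjugation into negation, and norm one then makes
  \<open>cd_mult_conj_self\<close> say that \<open>u\<close> squares to \<open>- cd_unit\<close>. So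
  \<open>u\<close> can play the role of the complex i.\<close>

locale imaginary_unit =
  fixes n :: nat and u :: "nat \<Rightarrow> real"
  assumes in_CD: "u \<in> CD n" and imaginary: "u 0 = 0" and norm: "(\<Sum>i<2 ^ n. (u i)\<^sup>2) = 1"
begin

lemma square: "cd_mult n u u = - cd_unit"
proof -
  have "- cd_mult n u u = cd_unit"
    using cd_mult_conj_self[OF in_CD] norm
    by (simp add: cd_conj_imaginary[OF in_CD imaginary] cd_mult_minus_left)
  then show ?thesis
    by (metis minus_minus)
qed

text \<open>Bilinearity reduces the product to those among \<open>cd_unit\<close> and
  \<open>u\<close>, which multiply like 1 and i; associativity of the algebra is never
  invoked.\<close>

lemma mult: "cd_mult n (complex_embed u z) (complex_embed u w) = complex_embed u (z * w)"
  unfolding complex_embed_def cd_mult_add_left cd_mult_add_right cd_mult_scale_left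
    cd_mult_scale_right square cd_mult_unit_left[OF in_CD] cd_mult_unit_right[OF in_CD]
    cd_mult_unit_left[OF cd_unit_in_CD]
  by (auto simp: algebra_simps)

lemma power: "cd_power n (complex_embed u z) m = complex_embed u (z ^ m)"
proof (induction m)
  case 0
  show ?case by (auto simp: complex_embed_def)
next
  case (Suc m)
  \<comment> \<open>\<open>cd_power\<close> appends the new factor on the right, the complex power
    on the left.\<close>
  then show ?case by (simp add: mult mult.commute)
qed

lemma monic_poly:
  assumes "\<And>i. i < k \<Longrightarrow> \<xi> i = complex_embed u (c i)"
  shows "cd_monic_poly n k \<xi> (complex_embed u z)
    = complex_embed u ((\<Sum>i<k. c i * z ^ i) + z ^ k)"
  by (simp add: cd_monic_poly_def power assms mult complex_embed_add complex_embed_sum)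

end

section \<open>Complex roots, and one copy containing all coefficients\<close>

lemma complex_monic_root:
  fixes c :: "nat \<Rightarrow> complex"
  assumes "k \<ge> 1"
  shows "\<exists>z. (\<Sum>i<k. c i * z ^ i) + z ^ k = 0"
proof -
  define p where "p = (\<Sum>i<k. monom (c i) i) + monom 1 k"
  \<comment> \<open>The sum stops below \<open>k\<close>, so only the monic term contributes here;
    the degree is thus at least \<open>k\<close>, hence positive.\<close>
  have "coeff p k = 1"
    by (simp add: p_def coeff_sum)
  then have "degree p \<noteq> 0"
    using assms le_degree[of p k] by simp
  then have "\<not> constant (poly p)"
    by (simp add: constant_degree)
  then obtain z where "poly p z = 0"
    using fundamental_theorem_of_algebra by blast
  then show ?thesis
    by (auto simp: p_def poly_sum poly_monom)
qed

lemma imaginary_unit_normalize: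
  assumes "v \<in> CD n" "v 0 = 0" "v \<noteq> 0"
  obtains r where "r \<noteq> 0" "imaginary_unit n (\<lambda>i. v i / r)"
proof -
  define s where "s = (\<Sum>i<2 ^ n. (v i)\<^sup>2)"
  obtain j where j: "v j \<noteq> 0"
    using assms(3) by (auto simp: fun_eq_iff)
  \<comment> \<open>Elements of \<open>CD n\<close> vanish from \<open>2 ^ n\<close> on, so the
    nonzero entry is counted in \<open>s\<close>.\<close>
  then have "j < 2 ^ n"
    using assms(1) by (auto simp: CD_def simp flip: not_le)
  then have "s > 0"
    unfolding s_def using j by (intro sum_pos2[of _ j]) auto
  have "(\<Sum>i<2 ^ n. (v i / sqrt s)\<^sup>2) = (\<Sum>i<2 ^ n. (v i)\<^sup>2) / (sqrt s)\<^sup>2"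
    by (simp add: power_divide sum_divide_distrib)
  also have "\<dots> = 1"
    unfolding s_def[symmetric] using \<open>s > 0\<close> by simp
  finally have "imaginary_unit n (\<lambda>i. v i / sqrt s)"
    using assms(1,2) by unfold_locales (simp_all add: CD_def)
  then show thesis
    using \<open>s > 0\<close> by (intro that[of "sqrt s"]) simp_all
qed

lemma C_dependent_imaginary_unit:
  assumes "n \<ge> 1" and "\<forall>x\<in>X. x \<in> CD n" and "\<forall>x\<in>X. \<forall>y\<in>X. C_dependent x y"
  obtains u where "imaginary_unit n u" "X \<subseteq> range (complex_embed u)"
proof (cases "\<forall>x\<in>X. cd_Im x = 0")
  case True
  \<comment> \<open>Real elements lie in every copy, so any imaginary unit serves; the basis vector
    of index 1 is available because \<open>n \<ge> 1\<close>.\<close>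
  have two: "2 ^ n \<ge> (2 :: nat)"
    using power_increasing[OF assms(1), of "2 :: nat"] by simp
  define u where "u = (\<lambda>i. if i = (1 :: nat) then 1 else (0 :: real))"
  have "(\<Sum>i<2 ^ n. (u i)\<^sup>2) = (\<Sum>i<2 ^ n. if i = (1 :: nat) then 1 else 0)"
    by (intro sum.cong) (auto simp: u_def)
  then have "imaginary_unit n u"
    using two by unfold_locales (auto simp: u_def CD_def)
  moreover have "x = complex_embed u (Complex (x 0) 0)" if "x \<in> X" for x
    using True that by (intro complex_embed_eqI) (auto simp: u_def)
  ultimately show thesis
    by (intro that) auto
next
  case False
  then obtain y where y: "y \<in> X" "cd_Im y \<noteq> 0"
    by blast
  have "cd_Im y \<in> CD n" "cd_Im y 0 = 0"
    using assms(2) y(1) by (auto simp: CD_def cd_Im_def)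
  then obtain r where r: "r \<noteq> 0" "imaginary_unit n (\<lambda>i. cd_Im y i / r)"
    using y(2) by (rule imaginary_unit_normalize)
  have "x \<in> range (complex_embed (\<lambda>i. cd_Im y i / r))" if "x \<in> X" for x
  proof -
    obtain a b where ab: "a \<noteq> 0 \<or> b \<noteq> 0" "(\<lambda>i. a * cd_Im x i + b * cd_Im y i) = 0"
      using assms(3) \<open>x \<in> X\<close> y(1) unfolding C_dependent_def by blast
    have eq: "a * cd_Im x i + b * cd_Im y i = 0" for i
      using fun_cong[OF ab(2), of i] by simp
    \<comment> \<open>Otherwise \<open>b\<close> is nonzero and the relation forces
      \<open>cd_Im y = 0\<close>, against the choice of \<open>y\<close>. Hence
      \<open>cd_Im x\<close> is a multiple of \<open>cd_Im y\<close>.\<close>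
    have "a \<noteq> 0"
      using ab(1) eq y(2) by (auto simp: fun_eq_iff)
    then have "cd_Im x i = (- b * r / a) * (cd_Im y i / r)" for i
      using eq[of i] r(1) by (simp add: field_simps)
    then have "cd_Im x = (\<lambda>i. (- b * r / a) * (cd_Im y i / r))"
      by (rule ext)
    from complex_embed_eqI[of "\<lambda>i. cd_Im y i / r", OF imaginary_unit.imaginary[OF r(2)] this]
    show ?thesis
      by (rule range_eqI)
  qed
  then show thesis
    by (intro that[OF r(2)] subsetI)
qed

theorem theorem3p2:
  fixes n k :: nat and \<xi> :: "nat \<Rightarrow> nat \<Rightarrow> real"
  assumes "n \<ge> 1" and "k \<ge> 1"
    and "\<forall>i<k. \<xi> i \<in> CD n"
    and "\<forall>i<k. \<forall>j<k. C_dependent (\<xi> i) (\<xi> j)"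
  shows "\<exists>x\<in>CD n. (\<forall>i<k. C_dependent x (\<xi> i)) \<and> cd_monic_poly n k \<xi> x = 0"
proof -
  obtain u where u: "imaginary_unit n u" and "\<xi> ` {..<k} \<subseteq> range (complex_embed u)"
    using C_dependent_imaginary_unit[of n "\<xi> ` {..<k}"] assms by auto
  then have "\<forall>i. \<exists>c. i < k \<longrightarrow> \<xi> i = complex_embed u c"
    by blast
  then obtain c where c: "\<And>i. i < k \<Longrightarrow> \<xi> i = complex_embed u (c i)"
    by metis
  interpret imaginary_unit n u by (rule u)
  obtain z where "(\<Sum>i<k. c i * z ^ i) + z ^ k = 0"
    using complex_monic_root[OF assms(2)] by blast
  then have "cd_monic_poly n k \<xi> (complex_embed u z) = 0"
    by (simp add: monic_poly c complex_embed_0)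
  \<comment> \<open>The root lies in the same copy as the coefficients, which makes it dependent
    with each of them.\<close>
  moreover have "\<forall>i<k. C_dependent (complex_embed u z) (\<xi> i)"
    by (simp add: c C_dependent_complex_embed imaginary)
  ultimately show ?thesis
    using complex_embed_in_CD[OF in_CD] by blast
qed

end
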